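(* Let $N,M\ge1$ be integers and let $0=v_0<v_1<\cdots<v_{M-1}<v_M=1$. Let $\bar f_i^c=\bar f_i^c(x,t)$, $i=0,\dots,M$, $c=1,\dots,N$, be a smooth solution with $r=\sum_{i=0}^M\bar f_i^N\neq 1$ of the system without relaxation $$\partial_t\bar f_i^c+v_i\partial_x\bar f_i^c-\frac{1}{1-r}I_i(\bar f^c,\partial_x\bar f^N)=0,\qquad i=0,\dots,M,\ c=1,\dots,N,$$ with $I_i$ defined in the context. Put $\bar\rho^c=\sum_{i=0}^M\bar f_i^c$ and $\bar q^c=\sum_{i=0}^M v_i\bar f_i^c$. Then for every $c=1,\dots,N$, $$\partial_t\bar\rho^c+\partial_x\bar q^c=0.$$ Moreover, for every $c=1,\dots,N-1$, the quantities $N_0^c=\bar\rho^c$ and $N_M^c=\dfrac{1-r}{\bar f_M^c}$ are conservative variables: they satisfy $$\partial_t N_0^c+\partial_x\bar q^c=0,\qquad \partial_t N_M^c+\partial_x N_M^c=0,$$ the latter wherever $\bar f_M^c\neq0$.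
   Context: Here $\bar f_i^c=f_i^1+\cdots+f_i^c$ are cumulative distributions of the first $c$ vehicle classes at discrete velocity $v_i$, and $r=\bar\rho^N=\sum_{i=0}^M\bar f_i^N$ is the total density. The interaction terms are $$I_0(\bar f^c,\partial_x\bar f^N)=\sum_{\ell=1}^M v_\ell\,\bar f_\ell^c\,\partial_x\bar f_0^N,$$ $$I_i(\bar f^c,\partial_x\bar f^N)=\sum_{\ell=i+1}^M(v_\ell-v_i)\bar f_\ell^c\,\partial_x\bar f_i^N-\sum_{\ell=0}^{i-1}(v_i-v_\ell)\bar f_i^c\,\partial_x\bar f_\ell^N,\qquad i=1,\dots,M-1,$$ $$I_M(\bar f^c,\partial_x\bar f^N)=-\sum_{\ell=0}^{M-1}(1-v_\ell)\bar f_M^c\,\partial_x\bar f_\ell^N.$$ *)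

theory Defs
  imports "HOL-Analysis.Analysis"
begin

text \<open>A point of the domain is a pair \<open>(x, t)\<close>. A family \<open>f i c\<close> stands for the cumulative
  distribution \<open>f_i^c = f_i^1 + \<dots> + f_i^c\<close> (bars omitted), with velocity index \<open>i \<le> M\<close> and class
  index \<open>c \<in> {1..N}\<close>. The cumulative distributions themselves are the unknowns; every family \<open>f i c\<close>
  is the cumulative family of its differences \<open>f i c - f i (c - 1)\<close> (with \<open>f i 0 = 0\<close>).\<close>

definition C1_on :: "(real \<times> real) set \<Rightarrow> (real \<times> real \<Rightarrow> real) \<Rightarrow> bool" where
  "C1_on \<Omega> g \<longleftrightarrow> (\<exists>g' :: real \<times> real \<Rightarrow> (real \<times> real) \<Rightarrow>\<^sub>L real. continuous_on \<Omega> g' \<and>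
     (\<forall>p\<in>\<Omega>. (g has_derivative blinfun_apply (g' p)) (at p)))"

text \<open>The library's \<open>deriv\<close> is unspecified where a function has no derivative; below it is
  used only for functions built from C1 functions on an open set, at points where no denominator
  vanishes.\<close>

definition dx :: "(real \<times> real \<Rightarrow> real) \<Rightarrow> real \<times> real \<Rightarrow> real" where
  "dx g p = deriv (\<lambda>x. g (x, snd p)) (fst p)"

definition dt :: "(real \<times> real \<Rightarrow> real) \<Rightarrow> real \<times> real \<Rightarrow> real" where
  "dt g p = deriv (\<lambda>t. g (fst p, t)) (snd p)"

text \<open>The interaction term \<open>I_i(u, w)\<close>, to be used with \<open>u l = f_l^c\<close> and \<open>w l = \<partial>\<^sub>x f_l^N\<close>.\<close>

definition interaction ::
  "nat \<Rightarrow> (nat \<Rightarrow> real) \<Rightarrow> nat \<Rightarrow> (nat \<Rightarrow> real) \<Rightarrow> (nat \<Rightarrow> real) \<Rightarrow> real" where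
  "interaction M v i u w =
     (if i = 0 then (\<Sum>l=1..M. v l * u l * w 0)
      else if i = M then - (\<Sum>l<M. (1 - v l) * u M * w l)
      else (\<Sum>l=i+1..M. (v l - v i) * u l * w i) - (\<Sum>l<i. (v i - v l) * u i * w l))"

definition cum_density :: "nat \<Rightarrow> (nat \<Rightarrow> nat \<Rightarrow> real \<times> real \<Rightarrow> real) \<Rightarrow> nat \<Rightarrow> real \<times> real \<Rightarrow> real" where
  "cum_density M f c p = (\<Sum>i\<le>M. f i c p)"

definition cum_flux ::
  "nat \<Rightarrow> (nat \<Rightarrow> real) \<Rightarrow> (nat \<Rightarrow> nat \<Rightarrow> real \<times> real \<Rightarrow> real) \<Rightarrow> nat \<Rightarrow> real \<times> real \<Rightarrow> real" where
  "cum_flux M v f c p = (\<Sum>i\<le>M. v i * f i c p)"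

definition N_0 :: "nat \<Rightarrow> (nat \<Rightarrow> nat \<Rightarrow> real \<times> real \<Rightarrow> real) \<Rightarrow> nat \<Rightarrow> real \<times> real \<Rightarrow> real" where
  "N_0 M f c p = cum_density M f c p"

definition N_M ::
  "nat \<Rightarrow> nat \<Rightarrow> (nat \<Rightarrow> nat \<Rightarrow> real \<times> real \<Rightarrow> real) \<Rightarrow> nat \<Rightarrow> real \<times> real \<Rightarrow> real" where
  "N_M N M f c p = (1 - cum_density M f N p) / f M c p"

text \<open>Smooth solutions are taken in the classical (C1) sense on an open set \<open>\<Omega>\<close>, which in
  particular covers solutions of class \<open>C\<^sup>\<infinity>\<close>.\<close>

definition smooth_solution ::
  "nat \<Rightarrow> nat \<Rightarrow> (nat \<Rightarrow> real) \<Rightarrow> (real \<times> real) set \<Rightarrow> (nat \<Rightarrow> nat \<Rightarrow> real \<times> real \<Rightarrow> real) \<Rightarrow> bool" where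
  "smooth_solution N M v \<Omega> f \<longleftrightarrow>
     (\<forall>i\<le>M. \<forall>c\<in>{1..N}. C1_on \<Omega> (f i c)) \<and>
     (\<forall>p\<in>\<Omega>. cum_density M f N p \<noteq> 1) \<and>
     (\<forall>i\<le>M. \<forall>c\<in>{1..N}. \<forall>p\<in>\<Omega>.
        dt (f i c) p + v i * dx (f i c) p
        - 1 / (1 - cum_density M f N p) * interaction M v i (\<lambda>l. f l c p) (\<lambda>l. dx (f l N) p) = 0)"

end

theory Submission
  imports Defs
begin

text \<open>The interaction terms are pairwise exchanges between velocities \<open>i < l\<close>, each entering
  \<open>I_i\<close> and \<open>I_l\<close> with opposite signs, so they sum to zero and the densities are conserved.
  For the fastest velocity \<open>I_M = - f_M^c (\<partial>\<^sub>x r - \<partial>\<^sub>x q^N)\<close>, hence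
  \<open>(\<partial>\<^sub>t + \<partial>\<^sub>x) f_M^c = - f_M^c (\<partial>\<^sub>x r - \<partial>\<^sub>x q^N) / (1 - r)\<close>, while conservation of \<open>r\<close> gives
  \<open>(\<partial>\<^sub>t + \<partial>\<^sub>x) (1 - r) = - (\<partial>\<^sub>x r - \<partial>\<^sub>x q^N)\<close>. Thus \<open>f_M^c\<close> and \<open>1 - r\<close> have the same logarithmic
  derivative along \<open>\<partial>\<^sub>t + \<partial>\<^sub>x\<close>, and their quotient is transported with speed 1.\<close>

text \<open>The boundary cases fit the generic formula: at \<open>i = 0\<close> the second sum is
  empty and \<open>v 0 = 0\<close>, at \<open>i = M\<close> the first sum is empty and
  \<open>v M = 1\<close>.\<close>

lemma interaction_eq:
  assumes "M \<ge> 1" "v 0 = 0" "v M = 1" "i \<le> M"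
  shows "interaction M v i u w =
    (\<Sum>l\<in>{i<..M}. (v l - v i) * u l * w i) - (\<Sum>l<i. (v i - v l) * u i * w l)"
  using assms by (auto simp: interaction_def atLeastSucAtMost_greaterThanAtMost)

lemma sum_interaction_eq_0:
  assumes "M \<ge> 1" "v 0 = 0" "v M = 1"
  shows "(\<Sum>i\<le>M. interaction M v i u w) = 0"
proof -
  \<comment> \<open>The exchange terms, extended by zero to the full square of index pairs:
    \<open>I_i\<close> becomes row sum \<open>i\<close> minus column sum \<open>i\<close> of
    \<open>a\<close>, and the total cancels by swapping the two summations.\<close>
  define a where "a i l = (if i < l then (v l - v i) * u l * w i else 0)" for i l
  have "interaction M v i u w = (\<Sum>l\<le>M. a i l) - (\<Sum>l\<le>M. a l i)" if "i \<le> M" for i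
  proof -
    have "(\<Sum>l\<le>M. a i l) = (\<Sum>l\<in>{i<..M}. (v l - v i) * u l * w i)"
      by (rule sum.mono_neutral_cong_right) (auto simp: a_def)
    moreover have "(\<Sum>l\<le>M. a l i) = (\<Sum>l<i. (v i - v l) * u i * w l)"
      using that by (intro sum.mono_neutral_cong_right) (auto simp: a_def)
    ultimately show ?thesis
      using interaction_eq[OF assms that] by simp
  qed
  then have "(\<Sum>i\<le>M. interaction M v i u w) = (\<Sum>i\<le>M. \<Sum>l\<le>M. a i l) - (\<Sum>i\<le>M. \<Sum>l\<le>M. a l i)"
    by (simp add: sum_subtractf)
  also have "\<dots> = 0"
    using sum.swap[of a "{..M}" "{..M}"] by simp
  finally show ?thesis .
qed

lemma interaction_max_velocity:
  assumes "M \<ge> 1" "v M = 1"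
  shows "interaction M v M u w = - u M * ((\<Sum>l\<le>M. w l) - (\<Sum>l\<le>M. v l * w l))"
proof -
  have "(\<Sum>l\<le>M. w l) - (\<Sum>l\<le>M. v l * w l) = (\<Sum>l\<le>M. (1 - v l) * w l)"
    by (simp add: sum_subtractf left_diff_distrib)
  \<comment> \<open>The summand \<open>l = M\<close> vanishes because
    \<open>v M = 1\<close>.\<close>
  also have "\<dots> = (\<Sum>l<M. (1 - v l) * w l)"
    using assms by (simp add: lessThan_Suc_atMost[symmetric])
  finally show ?thesis
    using assms by (simp add: interaction_def sum_distrib_left sum_negf mult_ac)
qed

text \<open>\<open>dx\<close> and \<open>dt\<close> rest on \<open>deriv\<close>, which is
  informative only where a derivative exists. Existence follows by composing the total derivative
  with the coordinate lines through \<open>p\<close>.\<close>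

lemma C1_on_partials:
  assumes "C1_on \<Omega> g" "p \<in> \<Omega>"
  shows "((\<lambda>x. g (x, snd p)) has_field_derivative dx g p) (at (fst p))"
    and "((\<lambda>t. g (fst p, t)) has_field_derivative dt g p) (at (snd p))"
proof -
  obtain g' where g': "(g has_derivative g') (at p)"
    using assms unfolding C1_on_def by blast
  have "((\<lambda>x. g (x, snd p)) has_derivative (\<lambda>h. g' (h, 0))) (at (fst p))"
    by (rule has_derivative_compose[of "\<lambda>x. (x, snd p)", where g = g])
       (use g' in \<open>auto intro!: derivative_eq_intros\<close>)
  then have "(\<lambda>x. g (x, snd p)) differentiable at (fst p)"
    unfolding differentiable_def by blast
  then show "((\<lambda>x. g (x, snd p)) has_field_derivative dx g p) (at (fst p))"
    unfolding dx_def using DERIV_deriv_iff_real_differentiable by blast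
  have "((\<lambda>t. g (fst p, t)) has_derivative (\<lambda>h. g' (0, h))) (at (snd p))"
    by (rule has_derivative_compose[of "\<lambda>t. (fst p, t)", where g = g])
       (use g' in \<open>auto intro!: derivative_eq_intros\<close>)
  then have "(\<lambda>t. g (fst p, t)) differentiable at (snd p)"
    unfolding differentiable_def by blast
  then show "((\<lambda>t. g (fst p, t)) has_field_derivative dt g p) (at (snd p))"
    unfolding dt_def using DERIV_deriv_iff_real_differentiable by blast
qed

lemma cum_density_partials:
  assumes "\<And>i. i \<le> M \<Longrightarrow> C1_on \<Omega> (f i c)" "p \<in> \<Omega>"
  shows "((\<lambda>x. cum_density M f c (x, snd p)) has_field_derivative (\<Sum>i\<le>M. dx (f i c) p)) (at (fst p))"
    and "((\<lambda>t. cum_density M f c (fst p, t)) has_field_derivative (\<Sum>i\<le>M. dt (f i c) p)) (at (snd p))"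
  unfolding cum_density_def
  using assms by (auto intro!: DERIV_sum C1_on_partials)

lemma dx_cum_flux:
  assumes "\<And>i. i \<le> M \<Longrightarrow> C1_on \<Omega> (f i c)" "p \<in> \<Omega>"
  shows "dx (cum_flux M v f c) p = (\<Sum>i\<le>M. v i * dx (f i c) p)"
proof -
  have "((\<lambda>x. cum_flux M v f c (x, snd p)) has_field_derivative (\<Sum>i\<le>M. v i * dx (f i c) p)) (at (fst p))"
    unfolding cum_flux_def
    using assms by (auto intro!: DERIV_sum DERIV_cmult C1_on_partials)
  then show ?thesis
    unfolding dx_def[of "cum_flux M v f c"] by (rule DERIV_imp_deriv)
qed

text \<open>The factor \<open>1 / (1 - r)\<close> is common to all velocities, so summing the
  equations leaves it times the total interaction, which is zero.\<close>

lemma sum_dt_eq: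
  assumes M: "M \<ge> 1" and v: "v 0 = 0" "v M = 1"
    and sol: "smooth_solution N M v \<Omega> f" and c: "c \<in> {1..N}" and p: "p \<in> \<Omega>"
  shows "(\<Sum>i\<le>M. dt (f i c) p) = - (\<Sum>i\<le>M. v i * dx (f i c) p)"
proof -
  let ?I = "\<lambda>i. interaction M v i (\<lambda>l. f l c p) (\<lambda>l. dx (f l N) p)"
  have "dt (f i c) p = 1 / (1 - cum_density M f N p) * ?I i - v i * dx (f i c) p" if "i \<le> M" for i
  proof -
    have "dt (f i c) p + v i * dx (f i c) p - 1 / (1 - cum_density M f N p) * ?I i = 0"
      using sol c p that unfolding smooth_solution_def by blast
    then show ?thesis
      by linarith
  qed
  then have "(\<Sum>i\<le>M. dt (f i c) p)
      = 1 / (1 - cum_density M f N p) * (\<Sum>i\<le>M. ?I i) - (\<Sum>i\<le>M. v i * dx (f i c) p)"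
    by (simp add: sum_subtractf sum_distrib_left)
  then show ?thesis
    using sum_interaction_eq_0[OF M v] by simp
qed

lemma cum_density_conservation:
  assumes "M \<ge> 1" "v 0 = 0" "v M = 1" "smooth_solution N M v \<Omega> f" "c \<in> {1..N}" "p \<in> \<Omega>"
  shows "dt (cum_density M f c) p + dx (cum_flux M v f c) p = 0"
proof -
  have C1: "C1_on \<Omega> (f i c)" if "i \<le> M" for i
    using assms that unfolding smooth_solution_def by blast
  have "dt (cum_density M f c) p = (\<Sum>i\<le>M. dt (f i c) p)"
    unfolding dt_def[of "cum_density M f c"]
    by (rule DERIV_imp_deriv, rule cum_density_partials(2)[of M \<Omega> f c, OF C1 \<open>p \<in> \<Omega>\<close>])
  then show ?thesis
    using sum_dt_eq[OF assms] dx_cum_flux[of M \<Omega> f c, OF C1 \<open>p \<in> \<Omega>\<close>] by simp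
qed

lemma N_M_transport:
  assumes M: "M \<ge> 1" and v: "v 0 = 0" "v M = 1"
    and sol: "smooth_solution N M v \<Omega> f" and c: "c \<in> {1..N}" and p: "p \<in> \<Omega>"
    and nz: "f M c p \<noteq> 0"
  shows "dt (N_M N M f c) p + dx (N_M N M f c) p = 0"
proof -
  define R where "R = 1 - cum_density M f N p"
  define g where "g = f M c p"
  define rx where "rx = (\<Sum>i\<le>M. dx (f i N) p)"
  define qx where "qx = (\<Sum>i\<le>M. v i * dx (f i N) p)"
  \<comment> \<open>The numerator \<open>1 - r\<close> involves class \<open>N\<close>, whose
    regularity and conservation law are needed besides those of class \<open>c\<close>.\<close>
  have N: "N \<in> {1..N}"
    using c by simp
  have C1: "C1_on \<Omega> (f i k)" if "i \<le> M" "k \<in> {1..N}" for i k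
    using sol that unfolding smooth_solution_def by blast
  have R0: "R \<noteq> 0"
    using sol p unfolding smooth_solution_def R_def by auto
  have g0: "g \<noteq> 0"
    using nz by (simp add: g_def)
  note dens = cum_density_partials[of M \<Omega> f N, OF C1[OF _ N] p]
  note last = C1_on_partials[OF C1[OF order_refl c] p]
  have X: "dx (N_M N M f c) p = (- rx * g - R * dx (f M c) p) / (g * g)"
    unfolding dx_def[of "N_M N M f c"] N_M_def
    by (rule DERIV_imp_deriv)
       (use nz in \<open>auto intro!: derivative_eq_intros dens(1) last(1) simp: R_def g_def rx_def\<close>)
  \<comment> \<open>Conservation for class \<open>N\<close> turns the time derivative of
    \<open>1 - r\<close> into \<open>qx\<close>.\<close>
  have T: "dt (N_M N M f c) p = (qx * g - R * dt (f M c) p) / (g * g)"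
    unfolding dt_def[of "N_M N M f c"] N_M_def
    by (rule DERIV_imp_deriv)
       (use nz sum_dt_eq[OF M v sol N p] in
         \<open>auto intro!: derivative_eq_intros dens(2) last(2) simp: R_def g_def qx_def\<close>)
  have "dt (f M c) p + v M * dx (f M c) p
      - 1 / R * interaction M v M (\<lambda>l. f l c p) (\<lambda>l. dx (f l N) p) = 0"
    using sol c p unfolding smooth_solution_def R_def by blast
  then have "R * (dt (f M c) p + dx (f M c) p) = - g * (rx - qx)"
    using R0 v(2) interaction_max_velocity[of M v "\<lambda>l. f l c p" "\<lambda>l. dx (f l N) p", OF M v(2)]
    by (simp add: g_def rx_def qx_def field_simps)
  \<comment> \<open>The numerators of \<open>T\<close> and \<open>X\<close> cancel, and both have
    the denominator \<open>g * g\<close>.\<close>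
  then have "(qx * g - R * dt (f M c) p) + (- rx * g - R * dx (f M c) p) = 0"
    by (simp add: algebra_simps)
  then show ?thesis
    unfolding X T by (simp add: add_divide_distrib[symmetric])
qed

theorem mainTheorem4:
  fixes N M :: nat
    and v :: "nat \<Rightarrow> real"
    and \<Omega> :: "(real \<times> real) set"
    and f :: "nat \<Rightarrow> nat \<Rightarrow> real \<times> real \<Rightarrow> real"
  assumes "N \<ge> 1" and "M \<ge> 1"
    and "strict_mono_on {..M} v" and "v 0 = 0" and "v M = 1"
    and "open \<Omega>"
    and "smooth_solution N M v \<Omega> f"
  shows "(\<forall>c\<in>{1..N}. \<forall>p\<in>\<Omega>. dt (cum_density M f c) p + dx (cum_flux M v f c) p = 0) \<and>
         (\<forall>c\<in>{1..<N}.
            (\<forall>p\<in>\<Omega>. dt (N_0 M f c) p + dx (cum_flux M v f c) p = 0) \<and>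
            (\<forall>p\<in>\<Omega>. f M c p \<noteq> 0 \<longrightarrow> dt (N_M N M f c) p + dx (N_M N M f c) p = 0))"
proof -
  have "N_0 M f c = cum_density M f c" for c
    by (simp add: N_0_def fun_eq_iff)
  then show ?thesis
    using cum_density_conservation[OF assms(2,4,5,7)] N_M_transport[OF assms(2,4,5,7)] by auto
qed

end
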